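(* For every positive integer $n$ and every tree $T$ on $n$ vertices, $h(T)\ge n^{1/3}-1$.
   Context: For a graph $G$ and $S\subseteq V(G)$, the distance multiset $D(S)$ is the multiset of shortest-path distances in $G$ between all unordered pairs of distinct vertices of $S$. Two vertex sets $S_1,S_2$ are homometric if $D(S_1)=D(S_2)$. $h(G)$ is the largest integer $h$ such that $G$ contains two disjoint homometric sets $S_1,S_2$ with $|S_1|=|S_2|=h$. *)

theory Defs
  imports Complex_Main "HOL-Library.Multiset"
begin

definition simple_graph :: "'a set \<Rightarrow> 'a set set \<Rightarrow> bool" where
  "simple_graph V E \<longleftrightarrow> finite V \<and> (\<forall>e\<in>E. e \<subseteq> V \<and> card e = 2)"

(* A walk is given by its vertex sequence, so its number of edges is length xs - 1. *)
definition walk :: "'a set \<Rightarrow> 'a set set \<Rightarrow> 'a list \<Rightarrow> bool" where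
  "walk V E xs \<longleftrightarrow> xs \<noteq> [] \<and> set xs \<subseteq> V \<and> successively (\<lambda>x y. {x, y} \<in> E) xs"

definition connected_graph :: "'a set \<Rightarrow> 'a set set \<Rightarrow> bool" where
  "connected_graph V E \<longleftrightarrow>
     V \<noteq> {} \<and> (\<forall>u\<in>V. \<forall>v\<in>V. \<exists>xs. walk V E xs \<and> hd xs = u \<and> last xs = v)"

(* The vertices of a cycle are listed without repeating the starting vertex at the end. *)
definition cycle :: "'a set \<Rightarrow> 'a set set \<Rightarrow> 'a list \<Rightarrow> bool" where
  "cycle V E xs \<longleftrightarrow>
     walk V E xs \<and> distinct xs \<and> length xs \<ge> 3 \<and> {last xs, hd xs} \<in> E"

definition tree :: "'a set \<Rightarrow> 'a set set \<Rightarrow> bool" where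
  "tree V E \<longleftrightarrow> simple_graph V E \<and> connected_graph V E \<and> (\<nexists>xs. cycle V E xs)"

(* Only meaningful if u and v lie in the same component. *)
definition gdist :: "'a set \<Rightarrow> 'a set set \<Rightarrow> 'a \<Rightarrow> 'a \<Rightarrow> nat" where
  "gdist V E u v =
     (LEAST k. \<exists>xs. walk V E xs \<and> hd xs = u \<and> last xs = v \<and> length xs = Suc k)"

(* The distance of an unordered pair p = {u, v}; well defined because gdist is
   symmetric, see pair_dist_eq. *)
definition pair_dist :: "'a set \<Rightarrow> 'a set set \<Rightarrow> 'a set \<Rightarrow> nat" where
  "pair_dist V E p = (THE d. \<exists>u v. p = {u, v} \<and> d = gdist V E u v)"

definition distance_multiset :: "'a set \<Rightarrow> 'a set set \<Rightarrow> 'a set \<Rightarrow> nat multiset" where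
  "distance_multiset V E S = image_mset (pair_dist V E) (mset_set {p. p \<subseteq> S \<and> card p = 2})"

definition homometric :: "'a set \<Rightarrow> 'a set set \<Rightarrow> 'a set \<Rightarrow> 'a set \<Rightarrow> bool" where
  "homometric V E S1 S2 \<longleftrightarrow> distance_multiset V E S1 = distance_multiset V E S2"

definition homometric_sizes :: "'a set \<Rightarrow> 'a set set \<Rightarrow> nat set" where
  "homometric_sizes V E =
     {h. \<exists>S1 S2. S1 \<subseteq> V \<and> S2 \<subseteq> V \<and> S1 \<inter> S2 = {} \<and> homometric V E S1 S2 \<and>
                 card S1 = h \<and> card S2 = h}"

(* The set is finite and nonempty for finite V, see homometric_sizes_finite and
   homometric_sizes_nonempty. *)
definition homometric_number :: "'a set \<Rightarrow> 'a set set \<Rightarrow> nat" where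
  "homometric_number V E = Max (homometric_sizes V E)"

lemma walk_rev: "walk V E (rev xs) \<longleftrightarrow> walk V E xs"
  by (simp add: walk_def successively_rev insert_commute)

lemma gdist_commute: "gdist V E u v = gdist V E v u"
proof -
  have *: "\<exists>ys. walk V E ys \<and> hd ys = b \<and> last ys = a \<and> length ys = Suc k"
    if "walk V E xs" "hd xs = a" "last xs = b" "length xs = Suc k" for a b k and xs :: "'a list"
    using that by (intro exI[of _ "rev xs"]) (auto simp: walk_rev hd_rev last_rev)
  have "(\<exists>xs. walk V E xs \<and> hd xs = u \<and> last xs = v \<and> length xs = Suc k) \<longleftrightarrow>
        (\<exists>xs. walk V E xs \<and> hd xs = v \<and> last xs = u \<and> length xs = Suc k)" for k
    using * by blast
  then show ?thesis by (simp add: gdist_def)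
qed

lemma pair_dist_eq: "pair_dist V E {u, v} = gdist V E u v"
  unfolding pair_dist_def by (rule the_equality) (auto simp: doubleton_eq_iff gdist_commute)

lemma homometric_sizes_finite: "finite V \<Longrightarrow> finite (homometric_sizes V E)"
  by (rule finite_subset[of _ "{..card V}"]) (auto simp: homometric_sizes_def card_mono)

lemma homometric_sizes_nonempty: "homometric_sizes V E \<noteq> {}"
proof -
  have "0 \<in> homometric_sizes V E"
    unfolding homometric_sizes_def homometric_def by (auto intro!: exI[of _ "{}"])
  then show ?thesis by blast
qed

end

theory Submission
  imports Defs
begin

text \<open>
  A nonbacktracking walk in a tree repeats no vertex, since a shortest closed piece of it would be a
  cycle; hence such walks are geodesics. Let k be a positive integer with k^3 < n. If some path has
  2k vertices, its first and second halves of k vertices are homometric. Otherwise root the tree at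
  the middle of a longest path, so that every depth is less than k. Pairing up siblings within one
  layer gives two homometric sets, because the distance of two vertices of a layer is determined by
  their parents. If no layer yields k pairs, then each layer has at most 2(k - 1) vertices more than
  the previous one, because at most one child of each vertex stays unpaired. Summing over the k
  layers gives n \<le> k + k(k - 1)^2 \<le> k^3, a contradiction.
\<close>

text \<open>A local substitute for being a path: after concatenation only the junction needs
  checking, and in a tree the condition already forces distinct vertices.\<close>

definition nb_walk :: "'a set \<Rightarrow> 'a set set \<Rightarrow> 'a list \<Rightarrow> bool" where
  "nb_walk V E xs \<longleftrightarrow> walk V E xs \<and> (\<forall>i. i + 2 < length xs \<longrightarrow> xs ! i \<noteq> xs ! (i + 2))"

definition layer :: "'a set \<Rightarrow> 'a set set \<Rightarrow> 'a \<Rightarrow> nat \<Rightarrow> 'a set" where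
  "layer V E r i = {v \<in> V. gdist V E r v = i}"

definition children :: "'a set \<Rightarrow> 'a set set \<Rightarrow> 'a \<Rightarrow> 'a \<Rightarrow> 'a set" where
  "children V E r w = {v \<in> V. {w, v} \<in> E \<and> gdist V E r v = Suc (gdist V E r w)}"

section \<open>Nonbacktracking walks in arbitrary graphs\<close>

lemma walk_nth:
  "walk V E xs \<longleftrightarrow>
     xs \<noteq> [] \<and> set xs \<subseteq> V \<and> (\<forall>i. Suc i < length xs \<longrightarrow> {xs ! i, xs ! Suc i} \<in> E)"
  by (auto simp: walk_def successively_conv_nth)

lemma nb_walk_rev:
  assumes "nb_walk V E xs"
  shows "nb_walk V E (rev xs)"
proof -
  have "rev xs ! i \<noteq> rev xs ! (i + 2)" if "i + 2 < length xs" for i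
  proof -
    \<comment> \<open>Positions \<open>i\<close> and \<open>i + 2\<close> of \<open>rev xs\<close>
      are positions \<open>j + 2\<close> and \<open>j\<close> of \<open>xs\<close>.\<close>
    define j where "j = length xs - Suc (i + 2)"
    have "j + 2 < length xs" "length xs - Suc i = j + 2" using that by (auto simp: j_def)
    then show ?thesis using assms that by (auto simp: nb_walk_def rev_nth j_def)
  qed
  then show ?thesis using assms by (simp add: nb_walk_def walk_rev)
qed

lemma nb_walk_take:
  assumes "nb_walk V E xs" "0 < k"
  shows "nb_walk V E (take k xs)"
  using assms set_take_subset[of k xs] by (auto simp: nb_walk_def walk_nth)

lemma nb_walk_drop:
  assumes "nb_walk V E xs" "k < length xs"
  shows "nb_walk V E (drop k xs)"
  using assms set_drop_subset[of k xs] by (auto simp: nb_walk_def walk_nth add.assoc)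

text \<open>The only three consecutive vertices that lie in neither walk are centred at the
  junction, and \<open>turn\<close> handles them. It is vacuous if one of the walks is a single
  vertex.\<close>

lemma nb_walk_join:
  assumes xs: "nb_walk V E xs" and ys: "nb_walk V E ys" and eq: "last xs = hd ys"
    and turn: "2 \<le> length xs \<Longrightarrow> 2 \<le> length ys \<Longrightarrow> xs ! (length xs - 2) \<noteq> ys ! 1"
  shows "nb_walk V E (xs @ tl ys)"
proof -
  have ne: "xs \<noteq> []" "ys \<noteq> []" using xs ys by (auto simp: nb_walk_def walk_def)
  \<comment> \<open>The index of the junction vertex, which is shared by both walks; hence
    \<open>L\<close> and \<open>R\<close> both apply there.\<close>
  let ?l = "length xs - 1"
  have len: "length (xs @ tl ys) = ?l + length ys" "0 < length xs" "0 < length ys"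
    using ne by (cases xs; auto)+
  have L: "(xs @ tl ys) ! i = xs ! i" if "i \<le> ?l" for i
  proof -
    have "i < length xs" using that len(2) by linarith
    then show ?thesis by (simp add: nth_append)
  qed
  have R: "(xs @ tl ys) ! i = ys ! (i - ?l)" if "?l \<le> i" "i < ?l + length ys" for i
  proof (cases "i = ?l")
    case True
    then show ?thesis using ne eq by (simp add: nth_append last_conv_nth hd_conv_nth)
  next
    case False
    with that have "\<not> i < length xs" and eq: "i - ?l = Suc (i - length xs)"
      using len(2) by linarith+
    moreover have "i - length xs < length (tl ys)" using False that len(2) by simp
    ultimately show ?thesis unfolding eq by (simp add: nth_append nth_tl)
  qed
  have "{(xs @ tl ys) ! i, (xs @ tl ys) ! Suc i} \<in> E" if "Suc i < ?l + length ys" for i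
  proof (cases "Suc i \<le> ?l")
    case True
    then show ?thesis using xs L by (auto simp: nb_walk_def walk_nth)
  next
    case False
    then show ?thesis using ys that by (auto simp: R Suc_diff_le nb_walk_def walk_nth)
  qed
  moreover have "(xs @ tl ys) ! i \<noteq> (xs @ tl ys) ! (i + 2)" if "i + 2 < ?l + length ys" for i
  proof -
    consider "i + 2 \<le> ?l" | "i + 1 = ?l" | "?l \<le> i" by linarith
    then show ?thesis
    proof cases
      case 1
      then show ?thesis using xs by (auto simp: L nb_walk_def)
    next
      case 2
      then have "i = length xs - 2" "i + 2 - ?l = 1" by linarith+
      then have "(xs @ tl ys) ! i = xs ! (length xs - 2)" "(xs @ tl ys) ! (i + 2) = ys ! 1"
        using 2 that L[of i] R[of "i + 2"] by simp_all
      then show ?thesis using turn 2 that by auto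
    next
      case 3
      then have "i + 2 - ?l = (i - ?l) + 2" by simp
      moreover have "(i - ?l) + 2 < length ys" using 3 that by linarith
      ultimately show ?thesis using ys 3 that by (auto simp: R nb_walk_def)
    qed
  qed
  moreover have "set (xs @ tl ys) \<subseteq> V"
    using xs ys ne by (auto simp: nb_walk_def walk_def dest: list.set_sel(2))
  moreover have "xs @ tl ys \<noteq> []" using ne by simp
  ultimately show ?thesis unfolding nb_walk_def walk_nth len(1) by blast
qed

text \<open>A backtrack can be cut out, which shortens the walk by two edges and keeps its
  ends.\<close>

lemma shortest_walk_nb:
  assumes w: "walk V E xs" and len: "length xs = Suc (gdist V E (hd xs) (last xs))"
  shows "nb_walk V E xs"
proof (rule ccontr)
  assume "\<not> nb_walk V E xs"
  then obtain i where i: "i + 2 < length xs" "xs ! i = xs ! (i + 2)"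
    using w by (auto simp: nb_walk_def)
  \<comment> \<open>Entries \<open>i\<close> and \<open>i + 1\<close> are deleted. The rest starts
    with \<open>xs ! (i + 2)\<close>, which equals the deleted \<open>xs ! i\<close>, so the
    adjacency with the preceding vertex and the first vertex are preserved.\<close>
  let ?ys = "take i xs @ drop (i + 2) xs"
  have split: "xs = take i xs @ xs ! i # xs ! Suc i # drop (i + 2) xs"
    using i by (metis Cons_nth_drop_Suc Suc_lessD add_2_eq_Suc' id_take_nth_drop)
  have hd_drop: "hd (drop (i + 2) xs) = xs ! i" using i by (simp add: hd_drop_conv_nth)
  have "successively (\<lambda>x y. {x, y} \<in> E) ?ys"
  proof -
    have "successively (\<lambda>x y. {x, y} \<in> E) (take i xs @ xs ! i # xs ! Suc i # drop (i + 2) xs)"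
      using w split by (simp add: walk_def)
    then show ?thesis using hd_drop by (auto simp: successively_append_iff successively_Cons)
  qed
  moreover have "set ?ys \<subseteq> V"
    using w set_take_subset[of i xs] set_drop_subset[of "i + 2" xs] by (auto simp: walk_def)
  ultimately have "walk V E ?ys" using i by (simp add: walk_def)
  moreover have "hd ?ys = hd xs"
  proof (cases "i = 0")
    case True
    then show ?thesis using hd_drop i(1) by (cases xs) auto
  next
    case False
    then show ?thesis using i(1) by (cases xs; cases i) auto
  qed
  moreover have "last ?ys = last xs" using i by simp
  moreover have "length ?ys = Suc (length xs - 3)" using i by simp
  ultimately have "gdist V E (hd xs) (last xs) \<le> length xs - 3"
    unfolding gdist_def by (intro Least_le) blast
  then show False using len i by simp
qed

section \<open>Homometric sets from distance-preserving injections\<close>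

lemma isometric_image_homometric:
  assumes A: "finite A" and inj: "inj_on f A"
    and iso: "\<And>a b. a \<in> A \<Longrightarrow> b \<in> A \<Longrightarrow> a \<noteq> b \<Longrightarrow> gdist V E (f a) (f b) = gdist V E a b"
  shows "homometric V E A (f ` A)"
proof -
  let ?P = "\<lambda>S. {p. p \<subseteq> S \<and> card p = 2}"
  have "?P (f ` A) = (`) f ` ?P A"
  proof (intro equalityI subsetI)
    fix p assume "p \<in> ?P (f ` A)"
    then obtain q where q: "q \<subseteq> A" "p = f ` q" by (auto simp: subset_image_iff)
    then have "card q = card p" using inj by (metis card_image inj_on_subset)
    then show "p \<in> (`) f ` ?P A" using q \<open>p \<in> ?P (f ` A)\<close> by auto
  next
    fix p assume "p \<in> (`) f ` ?P A"
    then obtain q where "q \<subseteq> A" "card q = 2" "p = f ` q" by auto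
    then show "p \<in> ?P (f ` A)" using inj by (auto simp: card_image inj_on_subset)
  qed
  moreover have "inj_on ((`) f) (?P A)"
    using inj by (auto intro!: inj_onI simp: inj_on_image_eq_iff)
  ultimately have "mset_set (?P (f ` A)) = image_mset ((`) f) (mset_set (?P A))"
    by (simp add: image_mset_mset_set)
  moreover have "pair_dist V E (f ` p) = pair_dist V E p" if p: "p \<in> ?P A" for p
  proof -
    obtain a b where "p = {a, b}" "a \<noteq> b" using p by (auto simp: card_2_iff)
    then show ?thesis using p iso by (auto simp: pair_dist_eq)
  qed
  moreover have "finite (?P A)" using A by simp
  ultimately show ?thesis
    by (auto simp: homometric_def distance_multiset_def multiset.map_comp intro!: image_mset_cong)
qed

text \<open>Any \<open>k\<close>-element subset of \<open>A\<close> inherits the isometry and is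
  disjoint from its image, so a lower bound on \<open>card A\<close> is enough to realise the exact
  size \<open>k\<close>.\<close>

lemma isometric_image_homometric_size:
  assumes V: "finite V" "A \<subseteq> V" "f ` A \<subseteq> V - A" and inj: "inj_on f A" and k: "k \<le> card A"
    and iso: "\<And>a b. a \<in> A \<Longrightarrow> b \<in> A \<Longrightarrow> a \<noteq> b \<Longrightarrow> gdist V E (f a) (f b) = gdist V E a b"
  shows "k \<in> homometric_sizes V E"
proof -
  obtain B where B: "B \<subseteq> A" "card B = k" "finite B"
    using k by (metis obtain_subset_with_card_n)
  have injB: "inj_on f B" using inj B(1) by (rule inj_on_subset)
  have "homometric V E B (f ` B)"
    using B injB iso by (intro isometric_image_homometric) auto
  moreover have "B \<subseteq> V" "f ` B \<subseteq> V" "B \<inter> f ` B = {}" using V B by auto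
  ultimately show ?thesis
    unfolding homometric_sizes_def using B card_image[OF injB] by blast
qed

section \<open>Uniqueness of nonbacktracking walks in a tree\<close>

locale tree_graph =
  fixes V :: "'a set" and E :: "'a set set"
  assumes tree: "tree V E"
begin

lemma finite_V: "finite V"
  using tree by (simp add: tree_def simple_graph_def)

lemma edge_distinct: "{x, y} \<in> E \<Longrightarrow> x \<noteq> y"
  using tree by (fastforce simp: tree_def simple_graph_def)

lemma edge_in_V: "{x, y} \<in> E \<Longrightarrow> x \<in> V \<and> y \<in> V"
  using tree by (fastforce simp: tree_def simple_graph_def)

text \<open>Take a repetition with the least gap \<open>d\<close>. Minimality makes the
  \<open>d\<close> vertices before the return distinct; gap 1 would be a loop and gap 2 a backtrack,
  so they form a cycle.\<close>

lemma nb_walk_distinct: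
  assumes nb: "nb_walk V E xs"
  shows "distinct xs"
proof (rule ccontr)
  assume "\<not> distinct xs"
  then have "\<exists>d i. 0 < d \<and> i + d < length xs \<and> xs ! i = xs ! (i + d)" (is "\<exists>d. ?Q d")
    unfolding distinct_conv_nth by (metis less_imp_add_positive nat_neq_iff)
  then have ex: "\<exists>d. ?Q d" .
  define d where "d = (LEAST d. ?Q d)"
  have "?Q d" unfolding d_def using ex by (rule LeastI_ex)
  have min: "\<not> ?Q e" if "e < d" for e
    using that unfolding d_def by (rule not_less_Least)
  from \<open>?Q d\<close> obtain i where i: "0 < d" "i + d < length xs" "xs ! i = xs ! (i + d)" by blast
  let ?c = "take d (drop i xs)"
  have edge: "{xs ! j, xs ! Suc j} \<in> E" if "Suc j < length xs" for j
    using nb that by (simp add: nb_walk_def walk_nth)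
  have "d \<noteq> 1" using edge[of i] edge_distinct i by force
  moreover have "d \<noteq> 2" using nb i by (auto simp: nb_walk_def)
  ultimately have d: "3 \<le> d" using i by linarith
  have "nb_walk V E ?c" using nb i by (intro nb_walk_take nb_walk_drop) auto
  then have "walk V E ?c" by (simp add: nb_walk_def)
  moreover have "?c ! a \<noteq> ?c ! b" if "a < b" "b < d" for a b
  proof -
    have "i + a + (b - a) < length xs" "i + a + (b - a) = i + b" "0 < b - a" "b - a < d"
      using that i by auto
    then have "xs ! (i + a) \<noteq> xs ! (i + b)" using min[of "b - a"] by metis
    then show ?thesis using that i by simp
  qed
  then have "distinct ?c"
    using i by (simp add: distinct_conv_nth) (metis nat_neq_iff)
  moreover have "{last ?c, hd ?c} \<in> E"
  proof -
    have "last ?c = xs ! (i + d - 1)" using i d by (simp add: last_conv_nth)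
    moreover have "hd ?c = xs ! (i + d)" using i d by (simp add: hd_drop_conv_nth)
    ultimately show ?thesis using edge[of "i + d - 1"] i by simp
  qed
  ultimately have "cycle V E ?c" using i d by (simp add: cycle_def)
  then show False using tree by (auto simp: tree_def)
qed

lemma closed_nb_walk:
  assumes "nb_walk V E xs" "hd xs = last xs"
  shows "length xs = 1"
  using nb_walk_distinct[OF assms(1)] assms
  by (cases xs) (auto simp: nb_walk_def walk_def split: if_splits)

text \<open>Common initial vertices are stripped by induction. Where two walks diverge, one reversed
  and followed by the other would be a closed nonbacktracking walk with more than one
  vertex.\<close>

lemma nb_walk_unique:
  assumes "nb_walk V E xs" "nb_walk V E ys" "hd xs = hd ys" "last xs = last ys"
  shows "xs = ys"
  using assms
proof (induction xs arbitrary: ys)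
  case Nil
  then show ?case by (simp add: nb_walk_def walk_def)
next
  case (Cons x xs)
  obtain zs where ys: "ys = x # zs"
    using Cons.prems by (cases ys) (auto simp: nb_walk_def walk_def)
  show ?case
  proof (cases "xs = [] \<or> zs = []")
    case True
    then have "hd (x # xs) = last (x # xs) \<or> hd ys = last ys" using ys by auto
    then have "hd (x # xs) = last (x # xs)" "hd ys = last ys" using Cons.prems(3,4) by argo+
    then have "length (x # xs) = 1" "length ys = 1"
      using closed_nb_walk[OF Cons.prems(1)] closed_nb_walk[OF Cons.prems(2)] by blast+
    then show ?thesis using ys by simp
  next
    case ne: False
    have tl: "nb_walk V E xs" "nb_walk V E zs"
      using nb_walk_drop[OF Cons.prems(1), of 1] nb_walk_drop[OF Cons.prems(2), of 1] ne ys by auto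
    show ?thesis
    proof (cases "hd xs = hd zs")
      case True
      then show ?thesis using Cons.IH[OF tl(1) tl(2)] Cons.prems ne ys by simp
    next
      case False
      \<comment> \<open>The junction is \<open>x\<close>; its neighbours on the two sides are
        \<open>hd xs\<close> and \<open>hd zs\<close>, which differ.\<close>
      have "nb_walk V E (rev (x # xs) @ tl ys)"
      proof (rule nb_walk_join[OF nb_walk_rev[OF Cons.prems(1)] Cons.prems(2)])
        show "last (rev (x # xs)) = hd ys" using ys by simp
        show "rev (x # xs) ! (length (rev (x # xs)) - 2) \<noteq> ys ! 1"
          using False ne ys by (simp add: nth_append rev_nth hd_conv_nth)
      qed
      moreover have "hd (rev (x # xs) @ tl ys) = last (rev (x # xs) @ tl ys)"
        using Cons.prems ne ys by (simp add: hd_append hd_rev)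
      ultimately show ?thesis using closed_nb_walk ne ys by fastforce
    qed
  qed
qed

lemma geodesic_exists:
  assumes "u \<in> V" "v \<in> V"
  obtains xs where "nb_walk V E xs" "hd xs = u" "last xs = v" "length xs = Suc (gdist V E u v)"
proof -
  obtain ys where "walk V E ys" "hd ys = u" "last ys = v"
    using tree assms by (force simp: tree_def connected_graph_def)
  moreover from this have "length ys = Suc (length ys - 1)" by (cases ys) (auto simp: walk_def)
  ultimately have "\<exists>k xs. walk V E xs \<and> hd xs = u \<and> last xs = v \<and> length xs = Suc k" by blast
  from LeastI_ex[OF this] obtain xs
    where "walk V E xs" "hd xs = u" "last xs = v" "length xs = Suc (gdist V E u v)"
    unfolding gdist_def by blast
  with that shortest_walk_nb show ?thesis by metis
qed

text \<open>A shortest walk with the same ends is itself nonbacktracking, so by uniqueness it is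
  \<open>xs\<close>.\<close>

lemma gdist_nb_walk:
  assumes nb: "nb_walk V E xs"
  shows "gdist V E (hd xs) (last xs) = length xs - 1"
proof -
  have "hd xs \<in> V" "last xs \<in> V" using nb by (auto simp: nb_walk_def walk_def)
  then obtain ys where "nb_walk V E ys" "hd ys = hd xs" "last ys = last xs"
    "length ys = Suc (gdist V E (hd xs) (last xs))" by (rule geodesic_exists)
  with nb_walk_unique[OF nb] show ?thesis by force
qed

lemma gdist_nth:
  assumes nb: "nb_walk V E xs" and "i \<le> j" "j < length xs"
  shows "gdist V E (xs ! i) (xs ! j) = j - i"
proof -
  let ?ys = "drop i (take (Suc j) xs)"
  have "nb_walk V E ?ys" using assms by (intro nb_walk_drop nb_walk_take) auto
  moreover have "hd ?ys = xs ! i" using assms by (simp add: hd_drop_conv_nth)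
  moreover have "last ?ys = xs ! j" using assms by (simp add: last_conv_nth)
  ultimately show ?thesis using gdist_nb_walk[of ?ys] assms by simp
qed

section \<open>Long paths and a central vertex\<close>

lemma long_walk_homometric_size:
  assumes nb: "nb_walk V E xs" and len: "2 * k \<le> length xs"
  shows "k \<in> homometric_sizes V E"
proof -
  note dist = nb_walk_distinct[OF nb]
  have V: "set xs \<subseteq> V" using nb by (simp add: nb_walk_def walk_def)
  \<comment> \<open>The position of a vertex on \<open>xs\<close>, well defined because
    \<open>xs\<close> is distinct.\<close>
  define g where "g v = (THE i. i < length xs \<and> xs ! i = v)" for v
  have g: "g (xs ! i) = i" if "i < length xs" for i
    unfolding g_def using that dist by (intro the_equality) (auto simp: nth_eq_iff_index_eq)
  \<comment> \<open>Shift by \<open>k\<close> places along the path: it carries the first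
    \<open>k\<close> vertices to the next \<open>k\<close> and preserves differences of positions,
    hence distances.\<close>
  define f where "f v = xs ! (g v + k)" for v
  have f: "f (xs ! i) = xs ! (i + k)" if "i < k" for i using that len by (simp add: f_def g)
  let ?A = "(!) xs ` {..<k}"
  have inj: "inj_on ((!) xs) {..<k}"
    using dist len by (auto simp: inj_on_def nth_eq_iff_index_eq)
  show ?thesis
  proof (rule isometric_image_homometric_size[OF finite_V, of ?A f])
    show "?A \<subseteq> V" using V len by (auto intro!: subsetD[OF V])
    show "f ` ?A \<subseteq> V - ?A"
      using V len dist by (auto simp: f nth_eq_iff_index_eq intro!: subsetD[OF V])
    show "inj_on f ?A" using len dist by (auto simp: inj_on_def f nth_eq_iff_index_eq)
    show "k \<le> card ?A" using card_image[OF inj] by simp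
  next
    have le: "gdist V E (f (xs ! i)) (f (xs ! j)) = gdist V E (xs ! i) (xs ! j)"
      if "i \<le> j" "j < k" for i j
      using that len gdist_nth[OF nb, of i j] gdist_nth[OF nb, of "i + k" "j + k"] by (simp add: f)
    fix a b assume "a \<in> ?A" "b \<in> ?A"
    then obtain i j where "i < k" "j < k" "a = xs ! i" "b = xs ! j" by auto
    then show "gdist V E (f a) (f b) = gdist V E a b"
      using le[of i j] le[of j i] by (cases "i \<le> j") (auto simp: gdist_commute)
  qed
qed

text \<open>The root is the middle vertex of a longest nonbacktracking walk. A path from it to a
  vertex that is too far away can retrace at most one half of that walk, so together with the other
  half it would form a longer one.\<close>

lemma center_exists:
  obtains xs r where "nb_walk V E xs" "r \<in> V" "\<And>v. v \<in> V \<Longrightarrow> gdist V E r v \<le> length xs div 2"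
proof -
  obtain v where "v \<in> V" using tree by (auto simp: tree_def connected_graph_def)
  then have "nb_walk V E [v]" by (simp add: nb_walk_def walk_def)
  moreover have "length xs \<le> card V" if "nb_walk V E xs" for xs
    using nb_walk_distinct[OF that] that card_mono[OF finite_V, of "set xs"]
    by (simp add: distinct_card nb_walk_def walk_def)
  ultimately obtain xs where nb: "nb_walk V E xs"
    and max: "\<And>ys. nb_walk V E ys \<Longrightarrow> length ys \<le> length xs"
    using ex_has_greatest_nat[of "nb_walk V E" "[v]" length "Suc (card V)"] by (metis le_imp_less_Suc)
  define h where "h = length xs div 2"
  define r where "r = xs ! h"
  have ne: "0 < length xs" using nb by (auto simp: nb_walk_def walk_def)
  then have h: "h < length xs" by (simp add: h_def)
  then have r: "r \<in> V" using nb by (auto simp: nb_walk_def walk_def r_def)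
  have "gdist V E r x \<le> h" if x: "x \<in> V" for x
  proof (rule ccontr)
    assume far: "\<not> gdist V E r x \<le> h"
    obtain ps where ps: "nb_walk V E ps" "hd ps = r" "length ps = Suc (gdist V E r x)"
      using geodesic_exists[OF r x] by metis
    let ?l = "take (Suc h) xs" and ?r = "rev (drop h xs)"
    have l: "nb_walk V E ?l" "last ?l = hd ps"
      using nb_walk_take[OF nb, of "Suc h"] h ps by (simp_all add: take_Suc_conv_app_nth r_def)
    have r': "nb_walk V E ?r" "last ?r = hd ps"
      using nb h ps by (auto intro!: nb_walk_rev nb_walk_drop simp: last_rev hd_drop_conv_nth r_def)
    \<comment> \<open>With \<open>gdist V E r x\<close> at least \<open>h + 1\<close>, this join has
      at least \<open>2 * h + 2\<close> vertices, while \<open>xs\<close> has at most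
      \<open>2 * h + 1\<close>. So the join must backtrack, and only at \<open>r\<close>.\<close>
    have "\<not> nb_walk V E (?l @ tl ps)"
      using max[of "?l @ tl ps"] h far ps by (auto simp: h_def)
    then have L: "1 \<le> h" "xs ! (h - 1) = ps ! 1"
      using nb_walk_join[OF l(1) ps(1) l(2)] h by (auto simp: Suc_le_eq)
    have "\<not> nb_walk V E (?r @ tl ps)"
      using max[of "?r @ tl ps"] h far ps by auto
    then have R': "2 \<le> length ?r" "?r ! (length ?r - 2) = ps ! 1"
      using nb_walk_join[OF r'(1) ps(1) r'(2)] by blast+
    then have R: "h + 1 < length xs" "xs ! (h + 1) = ps ! 1"
      by (auto simp: rev_nth Suc_diff_Suc numeral_2_eq_2)
    \<comment> \<open>The vertex \<open>ps ! 1\<close> is now both the predecessor and the successor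
      of \<open>r\<close> on \<open>xs\<close>, so \<open>xs\<close> itself would backtrack.\<close>
    have "h - 1 + 2 = h + 1" using L by simp
    then show False using nb L R unfolding nb_walk_def by metis
  qed
  then show ?thesis using that nb r by (simp add: h_def)
qed

section \<open>Depth, children and parents in the rooted tree\<close>

lemma gdist_self: "v \<in> V \<Longrightarrow> gdist V E v v = 0"
  using gdist_nb_walk[of "[v]"] by (simp add: nb_walk_def walk_def)

text \<open>A walk that starts by moving away from the root keeps doing so. The geodesic from
  \<open>r\<close> reaches \<open>hd xs\<close> from a vertex nearer to the root, hence different
  from \<open>xs ! 1\<close>, so it can be prolonged by \<open>xs\<close> to a nonbacktracking walk,
  which is again a geodesic.\<close>

lemma gdist_descending:
  assumes r: "r \<in> V" and nb: "nb_walk V E xs" and len: "2 \<le> length xs"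
    and down: "gdist V E r (xs ! 1) = Suc (gdist V E r (hd xs))"
  shows "gdist V E r (last xs) = gdist V E r (hd xs) + (length xs - 1)"
proof -
  have "hd xs \<in> V" using nb by (auto simp: nb_walk_def walk_def)
  then obtain ps where ps: "nb_walk V E ps" "hd ps = r" "last ps = hd xs"
    "length ps = Suc (gdist V E r (hd xs))" using geodesic_exists[OF r] by metis
  have ps0: "ps ! 0 = r" "ps \<noteq> []"
    using ps by (auto simp: hd_conv_nth simp flip: length_greater_0_conv)
  have join: "nb_walk V E (ps @ tl xs)"
  proof (rule nb_walk_join[OF ps(1) nb ps(3)])
    assume "2 \<le> length ps"
    then have "gdist V E r (ps ! (length ps - 2)) = length ps - 2"
      using gdist_nth[OF ps(1), of 0 "length ps - 2"] ps0 by simp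
    then show "ps ! (length ps - 2) \<noteq> xs ! 1" using ps(4) down by auto
  qed
  have "tl xs \<noteq> []" using len by (cases xs) auto
  then have "last (ps @ tl xs) = last xs" by (simp add: last_tl)
  moreover have "hd (ps @ tl xs) = r" using ps ps0 by simp
  ultimately show ?thesis using gdist_nb_walk[OF join] ps by simp
qed

text \<open>The geodesic from \<open>w\<close> to \<open>w'\<close> is extended by one edge at each
  end. A backtrack at an end would make this geodesic start downwards from there and finish at a
  greater depth, although \<open>w\<close> and \<open>w'\<close> have equal depth. The case
  \<open>w = w'\<close> is included, where \<open>u \<noteq> u'\<close> excludes the
  backtrack.\<close>

lemma gdist_children:
  assumes r: "r \<in> V" and V: "w \<in> V" "w' \<in> V" and same: "gdist V E r w = gdist V E r w'"
    and u: "u \<in> children V E r w" and u': "u' \<in> children V E r w'" and "u \<noteq> u'"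
  shows "gdist V E u u' = gdist V E w w' + 2"
proof -
  obtain ps where ps: "nb_walk V E ps" "hd ps = w" "last ps = w'"
    "length ps = Suc (gdist V E w w')" using geodesic_exists[OF V] by metis
  have up: "gdist V E r u = Suc (gdist V E r w)" "gdist V E r u' = Suc (gdist V E r w')"
    using u u' by (auto simp: children_def)
  have ne: "ps \<noteq> []" using ps by auto
  have E: "nb_walk V E [u, w]" "nb_walk V E [w', u']"
    using u u' V by (auto simp: children_def nb_walk_def walk_def insert_commute)
  have "nb_walk V E ([u, w] @ tl ps)"
  proof (rule nb_walk_join[OF E(1) ps(1)])
    assume "2 \<le> length ps"
    then show "[u, w] ! (length [u, w] - 2) \<noteq> ps ! 1"
      using gdist_descending[OF r ps(1)] up(1) same ps by auto
  qed (use ps in simp)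
  moreover have "[u, w] @ tl ps = u # ps" using ps ne by (cases ps) auto
  ultimately have up_walk: "nb_walk V E (u # ps)" by simp
  have "nb_walk V E ((u # ps) @ tl [w', u'])"
  proof (rule nb_walk_join[OF up_walk E(2)])
    show "last (u # ps) = hd [w', u']" using ps ne by simp
    show "(u # ps) ! (length (u # ps) - 2) \<noteq> [w', u'] ! 1"
    proof (cases "length ps = 1")
      case True
      then show ?thesis using \<open>u \<noteq> u'\<close> by simp
    next
      case False
      with ps(4) have long: "2 \<le> length ps" by simp
      \<comment> \<open>The vertex before \<open>w'\<close> is the second one of
        \<open>rev ps\<close>, so the descent argument applies to the reversed geodesic.\<close>
      have "rev ps ! 1 = (u # ps) ! (length (u # ps) - 2)"
        using long by (simp add: rev_nth nth_Cons' numeral_2_eq_2)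
      moreover have "rev ps ! 1 \<noteq> u'"
        using gdist_descending[OF r nb_walk_rev[OF ps(1)]] up(2) same ps long ne
        by (auto simp: hd_rev last_rev)
      ultimately show ?thesis by simp
    qed
  qed
  from gdist_nb_walk[OF this] show ?thesis using ps by simp
qed

lemma parent_exists:
  assumes r: "r \<in> V" and v: "v \<in> V" "gdist V E r v = Suc i"
  shows "\<exists>w \<in> layer V E r i. v \<in> children V E r w"
proof -
  obtain ps where ps: "nb_walk V E ps" "hd ps = r" "last ps = v" "length ps = Suc (Suc i)"
    using geodesic_exists[OF r v(1)] v(2) by metis
  have nth: "ps ! 0 = r" "ps ! Suc i = v"
    using ps by (auto simp: hd_conv_nth last_conv_nth simp flip: length_greater_0_conv)
  have "gdist V E r (ps ! i) = i" using gdist_nth[OF ps(1), of 0 i] nth ps by simp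
  moreover have "{ps ! i, v} \<in> E" using ps nth by (auto simp: nb_walk_def walk_nth)
  ultimately show ?thesis using v edge_in_V by (auto simp: layer_def children_def)
qed

text \<open>Otherwise the walk \<open>[w, v, w']\<close> starts away from the root and hence ends
  two levels below \<open>w\<close>, but both parents lie one level above \<open>v\<close>.\<close>

lemma parent_unique:
  assumes r: "r \<in> V" and "w \<in> V" "w' \<in> V" and v: "v \<in> children V E r w" "v \<in> children V E r w'"
  shows "w = w'"
proof (rule ccontr)
  assume "w \<noteq> w'"
  moreover have "{w, v} \<in> E" "{v, w'} \<in> E" "v \<in> V"
    using v by (auto simp: children_def insert_commute)
  ultimately have nb: "nb_walk V E [w, v, w']"
    using assms by (simp add: nb_walk_def walk_def)
  have "gdist V E r w' = gdist V E r w + 2"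
    using gdist_descending[OF r nb] v by (simp add: children_def)
  then show False using v by (simp add: children_def)
qed

section \<open>Homometric sets from pairs of siblings\<close>

lemma sibling_pairs_homometric_size:
  assumes r: "r \<in> V" and k: "k \<le> (\<Sum>w\<in>layer V E r i. card (children V E r w) div 2)"
  shows "k \<in> homometric_sizes V E"
proof -
  let ?L = "layer V E r i" and ?C = "children V E r"
  have C: "finite (?C w)" "?C w \<subseteq> V" for w
    using finite_V by (auto simp: children_def)
  have L: "finite ?L" "?L \<subseteq> V" using finite_V by (auto simp: layer_def)
  \<comment> \<open>Among the children of each \<open>w\<close>, half of them, rounded down, are
    matched injectively with others.\<close>
  have "\<exists>A g. A \<subseteq> ?C w \<and> card A = card (?C w) div 2 \<and> inj_on g A \<and> g ` A \<subseteq> ?C w - A" for w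
  proof -
    obtain A where A: "A \<subseteq> ?C w" "card A = card (?C w) div 2"
      by (metis div_le_dividend obtain_subset_with_card_n)
    moreover have "card A \<le> card (?C w - A)"
      using A C by (simp add: card_Diff_subset finite_subset)
    ultimately show ?thesis
      using card_le_inj[of A "?C w - A"] C by (metis finite_Diff finite_subset)
  qed
  then obtain A g where A: "\<And>w. A w \<subseteq> ?C w" "\<And>w. card (A w) = card (?C w) div 2"
    and g: "\<And>w. inj_on (g w) (A w)" "\<And>w. g w ` A w \<subseteq> ?C w - A w"
    by metis
  \<comment> \<open>The parent of \<open>v\<close>; it glues the separate matchings
    \<open>g w\<close> into one map \<open>f\<close> that keeps parents fixed.\<close>
  define p where "p v = (THE w. w \<in> V \<and> v \<in> ?C w)" for v
  have p: "p v = w" if "w \<in> ?L" "v \<in> ?C w" for v w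
    unfolding p_def using that L parent_unique[OF r] by (intro the_equality) auto
  define f where "f v = g (p v) v" for v
  have f: "f v \<in> ?C w - A w" "f v = g w v" if "w \<in> ?L" "v \<in> A w" for v w
    using that p[of w v] A(1)[of w] g(2)[of w] by (auto simp: f_def)
  have pf: "p (f v) = w" if "w \<in> ?L" "v \<in> A w" for v w
    using f[OF that] p that by blast
  let ?A = "\<Union>w\<in>?L. A w"
  have inj: "inj_on f ?A"
  proof (rule inj_onI)
    fix a b assume "a \<in> ?A" "b \<in> ?A" and eq: "f a = f b"
    then obtain w w' where w: "w \<in> ?L" "a \<in> A w" "w' \<in> ?L" "b \<in> A w'" by auto
    then have "w = w'" using pf eq by metis
    then show "a = b" using w eq f(2) g(1)[of w] by (auto dest: inj_onD)
  qed
  show ?thesis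
  proof (rule isometric_image_homometric_size[OF finite_V, of ?A f])
    show "?A \<subseteq> V" using A C by blast
    show "inj_on f ?A" by (fact inj)
    show "f ` ?A \<subseteq> V - ?A"
    proof (intro image_subsetI DiffI notI)
      fix a assume "a \<in> ?A"
      then obtain w where w: "w \<in> ?L" "a \<in> A w" by auto
      show "f a \<in> V" using f(1)[OF w] C by blast
      assume "f a \<in> ?A"
      then obtain w' where w': "w' \<in> ?L" "f a \<in> A w'" by auto
      then have "p (f a) = w'" using p A(1) by blast
      then have "w = w'" using pf[OF w] by simp
      then show False using f(1)[OF w] w' by blast
    qed
    have "A w \<inter> A w' = {}" if "w \<in> ?L" "w' \<in> ?L" "w \<noteq> w'" for w w'
      using that p A(1) by blast
    then have "card ?A = (\<Sum>w\<in>?L. card (A w))"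
      using L finite_subset[OF A(1) C(1)] by (intro card_UN_disjoint) auto
    then show "k \<le> card ?A" using k A(2) by simp
  next
    fix a b assume "a \<in> ?A" "b \<in> ?A" "a \<noteq> b"
    then obtain w w' where w: "w \<in> ?L" "a \<in> A w" "w' \<in> ?L" "b \<in> A w'" by auto
    \<comment> \<open>Both pairs have the parents \<open>w\<close> and \<open>w'\<close>, so each is
      at distance \<open>gdist V E w w' + 2\<close>, also when \<open>w = w'\<close>.\<close>
    have ab: "a \<in> ?C w" "b \<in> ?C w'" "f a \<in> ?C w" "f b \<in> ?C w'"
      using w A(1) f(1) by blast+
    have "f a \<noteq> f b" using inj \<open>a \<in> ?A\<close> \<open>b \<in> ?A\<close> \<open>a \<noteq> b\<close> by (auto dest: inj_onD)
    moreover have V: "w \<in> V" "w' \<in> V" and same: "gdist V E r w = gdist V E r w'"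
      using w by (auto simp: layer_def)
    ultimately have "gdist V E (f a) (f b) = gdist V E w w' + 2"
      using gdist_children[OF r V same ab(3,4)] by blast
    also have "\<dots> = gdist V E a b"
      using gdist_children[OF r V same ab(1,2) \<open>a \<noteq> b\<close>] by (rule sym)
    finally show "gdist V E (f a) (f b) = gdist V E a b" .
  qed
qed

section \<open>Growth of the layers and counting\<close>

lemma layer_0: "r \<in> V \<Longrightarrow> layer V E r 0 = {r}"
proof -
  assume r: "r \<in> V"
  have "v = r" if v: "v \<in> V" "gdist V E r v = 0" for v
  proof -
    obtain ps where "hd ps = r" "last ps = v" "length ps = Suc 0"
      using geodesic_exists[OF r v(1)] v(2) by metis
    then show ?thesis by (auto simp: length_Suc_conv)
  qed
  then show ?thesis using r by (auto simp: layer_def gdist_self)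
qed

lemma card_layer_Suc:
  assumes r: "r \<in> V"
    and small: "(\<Sum>w\<in>layer V E r i. card (children V E r w) div 2) \<le> m"
  shows "card (layer V E r (Suc i)) \<le> card (layer V E r i) + 2 * m"
proof -
  let ?L = "layer V E r i" and ?C = "children V E r"
  have fin: "finite ?L" using finite_V by (simp add: layer_def)
  have "layer V E r (Suc i) \<subseteq> (\<Union>w\<in>?L. ?C w)"
    using parent_exists[OF r] by (force simp: layer_def)
  then have "card (layer V E r (Suc i)) \<le> card (\<Union>w\<in>?L. ?C w)"
    using fin finite_V by (intro card_mono) (auto simp: children_def)
  also have "\<dots> \<le> (\<Sum>w\<in>?L. card (?C w))" using fin by (rule card_UN_le)
  \<comment> \<open>At most one child of each vertex is left over by the pairing, whence the summand
    1.\<close>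
  also have "\<dots> \<le> (\<Sum>w\<in>?L. 1 + 2 * (card (?C w) div 2))" by (intro sum_mono) linarith
  also have "\<dots> = card ?L + 2 * (\<Sum>w\<in>?L. card (?C w) div 2)"
    unfolding sum.distrib sum_distrib_left by simp
  finally show ?thesis using small by linarith
qed

lemma homometric_size_if_cube_less:
  assumes k: "0 < k" "k ^ 3 < card V"
  shows "k \<in> homometric_sizes V E"
proof (rule ccontr)
  assume no: "k \<notin> homometric_sizes V E"
  obtain m where m: "k = Suc m" using k by (cases k) auto
  obtain xs r where nb: "nb_walk V E xs" and r: "r \<in> V"
    and ecc: "\<And>v. v \<in> V \<Longrightarrow> gdist V E r v \<le> length xs div 2" by (rule center_exists) blast
  have "length xs < 2 * k" using long_walk_homometric_size[OF nb] no by (meson not_le)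
  \<comment> \<open>The walk has at most \<open>2 * k - 1\<close> vertices, and half of that,
    rounded down, is at most \<open>k - 1\<close>.\<close>
  then have depth: "gdist V E r v < k" if "v \<in> V" for v using ecc[OF that] by linarith
  have "(\<Sum>w\<in>layer V E r i. card (children V E r w) div 2) \<le> m" for i
    using sibling_pairs_homometric_size[OF r, of k i] no m by (meson not_less_eq_eq)
  then have step: "card (layer V E r (Suc i)) \<le> card (layer V E r i) + 2 * m" for i
    using card_layer_Suc[OF r] by blast
  have layer: "card (layer V E r i) \<le> 1 + 2 * m * i" for i
  proof (induction i)
    case 0
    then show ?case by (simp add: layer_0[OF r])
  next
    case (Suc i)
    then show ?case using step[of i] by simp
  qed
  have "V = (\<Union>i<k. layer V E r i)" using depth by (auto simp: layer_def)
  then have "card V \<le> (\<Sum>i<k. card (layer V E r i))" by (metis card_UN_le finite_lessThan)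
  also have "\<dots> \<le> (\<Sum>i<k. 1 + 2 * m * i)" using layer by (intro sum_mono)
  also have "\<dots> = k + m * (2 * (\<Sum>i<k. i))"
    unfolding sum.distrib sum_distrib_left by (simp add: mult_ac)
  also have "2 * (\<Sum>i<k. i) = k * m" unfolding m by (induction m) (auto simp: algebra_simps)
  \<comment> \<open>Divided by \<open>k = m + 1\<close>, this reads
    \<open>1 + m^2 \<le> (m + 1)^2\<close>.\<close>
  also have "k + m * (k * m) \<le> k ^ 3" by (simp add: m power3_eq_cube algebra_simps)
  finally show False using k by simp
qed

end

section \<open>The cube root bound\<close>

theorem theorem4:
  fixes V :: "'a set" and E :: "'a set set" and n :: nat
  assumes "n \<ge> 1" and "tree V E" and "card V = n"
  shows "real (homometric_number V E) \<ge> real n powr (1 / 3) - 1"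
proof (rule ccontr)
  interpret tree_graph V E using assms(2) by unfold_locales
  \<comment> \<open>The first size beyond the maximum. If the bound failed, \<open>k\<close> would
    lie below the cube root of \<open>n\<close>, so size \<open>k\<close> would be attained as
    well.\<close>
  define k where "k = Suc (homometric_number V E)"
  assume "\<not> ?thesis"
  then have "real k < real n powr (1 / 3)" by (simp add: k_def)
  then have "real k ^ 3 < (real n powr (1 / 3)) ^ 3" by (intro power_strict_mono) auto
  also have "\<dots> = real n" using assms(1) by (simp add: powr_power)
  finally have "real (k ^ 3) < real n" by simp
  then have "k ^ 3 < n" by (simp only: of_nat_less_iff)
  then have "k \<in> homometric_sizes V E"
    using assms(3) by (intro homometric_size_if_cube_less) (auto simp: k_def)
  then have "k \<le> homometric_number V E"
    unfolding homometric_number_def by (intro Max_ge homometric_sizes_finite finite_V)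
  then show False by (simp add: k_def)
qed

end
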